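(* Let $n$ and $k$ be integers with $n-1>k\ge 1$, and let $G$ be a $k$-connected graph of order $n$. Then for every vertex $x$ of $G$, \[W(x,G)\le \tfrac{1}{2}\Big\lfloor \frac{n+k-2}{k}\Big\rfloor\Big(2n+k-2-k\Big\lfloor \frac{n+k-2}{k}\Big\rfloor\Big).\] Moreover, this bound is sharp when $k=1$ or $k\ge 2$ is even: in these cases there exist a $k$-connected graph $G$ of order $n$ and a vertex $x$ of $G$ for which equality holds.
   Context: All graphs are finite, simple and connected. A connected graph $G$ is $k$-connected if removing any $k-1$ vertices of $G$ leaves neither a disconnected graph nor a one-vertex graph. The order of $G$ is $|V(G)|$. For vertices $x,y$, $d_G(x,y)$ is the length of a shortest $x$–$y$ path, and the status of $x$ is $W(x,G)=\sum_{y\in V(G)} d_G(x,y)$. *)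

theory Defs
  imports Complex_Main "Graph_Theory.Graph_Theory"
begin

text \<open>
  A finite simple graph is a \<^locale>\<open>graph\<close>: finite, loop-free, without parallel arcs, and with a
  symmetric arc set, so that an undirected edge is a pair of opposite arcs. The name \<open>connected\<close> is
  qualified because it also denotes topological connectedness.
\<close>

text \<open>
  The removed set has exactly \<open>k - 1\<close> vertices, so the condition is vacuous for graphs with fewer
  than \<open>k - 1\<close> vertices; it is only meant to be used for graphs of order at least \<open>k\<close>. The empty graph is not
  connected.
\<close>

definition k_connected :: "nat \<Rightarrow> ('a, 'b) pre_digraph \<Rightarrow> bool" where
  "k_connected k G \<longleftrightarrow> graph G \<and> Digraph_Component.connected G \<and>
     (\<forall>S \<subseteq> verts G. card S = k - 1 \<longrightarrow>
        Digraph_Component.connected (G \<restriction> (verts G - S)) \<and> card (verts (G \<restriction> (verts G - S))) \<noteq> 1)"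

text \<open>Meaningful only if some path from \<open>x\<close> to \<open>y\<close> exists, in particular in connected graphs.\<close>

definition graph_dist :: "('a, 'b) pre_digraph \<Rightarrow> 'a \<Rightarrow> 'a \<Rightarrow> nat" where
  "graph_dist G x y = (LEAST l. \<exists>p. pre_digraph.apath G x p y \<and> length p = l)"

definition status :: "'a \<Rightarrow> ('a, 'b) pre_digraph \<Rightarrow> nat" where
  "status x G = (\<Sum>y\<in>verts G. graph_dist G x y)"

end

theory Submission
  imports Defs
begin

text \<open>
  Upper bound: fix \<open>x\<close> and let \<open>r j\<close> be the number of vertices at distance more than \<open>j\<close> from \<open>x\<close>.
  If \<open>r (j + 1) > 0\<close>, then the sphere of radius \<open>j + 1\<close> separates \<open>x\<close> from the vertices beyond it
  and hence has at least \<open>k\<close> vertices. So \<open>r j \<le> n - 1 - j k\<close> (truncated at 0), and the status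
  is the sum of the \<open>r j\<close>.

  Sharpness: in the \<open>k\<close>-th power of the path \<open>0, \<dots>, n - 1\<close> a vertex \<open>v > j k\<close> has distance more
  than \<open>j\<close> from \<open>0\<close>, so all the bounds on \<open>r j\<close> are attained. This power is \<open>k\<close>-connected: once
  \<open>k - 1\<close> vertices are removed, consecutive remaining ones still differ by at most \<open>k\<close>.
\<close>

section \<open>Summation by levels and the closed form of the bound\<close>

lemma sum_eq_sum_card_greater:
  fixes g :: "'a \<Rightarrow> nat"
  assumes "finite A" "\<And>y. y \<in> A \<Longrightarrow> g y \<le> m"
  shows "(\<Sum>y\<in>A. g y) = (\<Sum>j<m. card {y \<in> A. j < g y})"
proof -
  have "(\<Sum>y\<in>A. g y) = (\<Sum>y\<in>A. card {j \<in> {..<m}. j < g y})"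
  proof (rule sum.cong)
    fix y assume "y \<in> A"
    hence "{j \<in> {..<m}. j < g y} = {..<g y}" using assms(2)[of y] by auto
    thus "g y = card {j \<in> {..<m}. j < g y}" by simp
  qed simp
  \<comment> \<open>Double counting of the pairs \<open>(y, j)\<close> with
    \<open>j < g y\<close>.\<close>
  also have "\<dots> = (\<Sum>j<m. card {y \<in> A. j < g y})"
    using sum_multicount_gen[of A "{..<m}" "\<lambda>y j. j < g y" "\<lambda>j. card {y \<in> A. j < g y}"] assms(1)
    by auto
  finally show ?thesis .
qed

lemma floor_eq_div:
  fixes n k :: nat
  assumes "n \<ge> 2"
  shows "\<lfloor>(real n + real k - 2) / real k\<rfloor> = int ((n + k - 2) div k)"
proof -
  have "real n + real k - 2 = real (n + k - 2)" using assms by (simp add: of_nat_diff)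
  thus ?thesis by (simp only: floor_divide_of_nat_eq)
qed

text \<open>Exactly \<open>q\<close> terms are positive, because \<open>q\<close> is
  \<open>(n - 1) / k\<close> rounded up; from index \<open>q\<close> on, truncated subtraction gives
  0. What remains is an arithmetic series.\<close>

lemma sum_truncated_progression:
  fixes n k :: nat
  assumes "n \<ge> 2" "k \<ge> 1"
  defines "q \<equiv> (n + k - 2) div k"
  shows "real (\<Sum>j<n. n - 1 - j * k) = 1 / 2 * real q * (2 * real n + real k - 2 - real k * real q)"
proof -
  have lt: "q * k \<le> n + k - 2" by (simp add: q_def)
  have gt: "n + k - 2 < q * k + k"
    unfolding q_def using assms(2) by (simp add: dividend_less_div_times add.commute)
  have "q \<le> n"
  proof (rule ccontr)
    assume "\<not> q \<le> n"
    hence "(n + 1) * k \<le> q * k" by (intro mult_right_mono) auto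
    moreover have "n \<le> n * k" using assms(2) by simp
    ultimately show False using lt assms(1,2) unfolding add_mult_distrib by linarith
  qed
  have "(\<Sum>j<n. n - 1 - j * k) = (\<Sum>j<q. n - 1 - j * k)"
  proof (rule sum.mono_neutral_right)
    show "\<forall>j\<in>{..<n} - {..<q}. n - 1 - j * k = 0"
    proof
      fix j assume "j \<in> {..<n} - {..<q}"
      hence "q * k \<le> j * k" by (intro mult_right_mono) auto
      thus "n - 1 - j * k = 0" using gt assms(1) by linarith
    qed
  qed (use \<open>q \<le> n\<close> in auto)
  also have "real \<dots> = (\<Sum>j<q. real n - 1 - real j * real k)"
    unfolding of_nat_sum
  proof (rule sum.cong)
    fix j assume "j \<in> {..<q}"
    hence "(j + 1) * k \<le> q * k" by (intro mult_right_mono) auto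
    hence "j * k \<le> n - 1" using lt unfolding add_mult_distrib by linarith
    thus "real (n - 1 - j * k) = real n - 1 - real j * real k" using assms(1)
      by (simp add: of_nat_diff)
  qed simp
  \<comment> \<open>The truncation is gone, so this is a polynomial identity that follows by
    induction on \<open>q\<close>.\<close>
  also have "\<dots> = 1 / 2 * real q * (2 * real n + real k - 2 - real k * real q)"
    by (induction q) (simp_all add: field_simps)
  finally show ?thesis .
qed

section \<open>Reachability, induced subgraphs and distances\<close>

lemma (in graph) connected_imp_reachable:
  assumes "Digraph_Component.connected G" "u \<in> verts G" "v \<in> verts G"
  shows "u \<rightarrow>\<^sup>* v"
  using symmetric_connected_imp_strongly_connected[OF sym_arcs assms(1)] assms(2,3)
  by (simp add: strongly_connected_def)

lemma (in graph) graph_induce_subgraph: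
  assumes "S \<subseteq> verts G"
  shows "graph (G \<restriction> S)"
proof -
  interpret H: digraph "G \<restriction> S" using assms by (intro digraphI_induced induced_induce)
  show ?thesis
    using assms by (intro H.graphI induced_graph_imp_symmetric[OF sym_arcs] induced_induce)
qed

context wf_digraph
begin

lemma graph_dist_le: "apath x p y \<Longrightarrow> graph_dist G x y \<le> length p"
  unfolding graph_dist_def by (rule Least_le) blast

lemma graph_dist_apathE:
  assumes "x \<rightarrow>\<^sup>* y"
  obtains p where "apath x p y" "length p = graph_dist G x y"
proof -
  have "\<exists>l p. apath x p y \<and> length p = l" using assms reachable_apath by simp
  thus ?thesis
    using that LeastI_ex[of "\<lambda>l. \<exists>p. apath x p y \<and> length p = l"] unfolding graph_dist_def by blast
qed

lemma graph_dist_self: "x \<in> verts G \<Longrightarrow> graph_dist G x x = 0"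
  using graph_dist_le[of x "[]" x] by (simp add: apath_Nil_iff)

text \<open>\<open>graph_dist\<close> minimises over paths without repeated vertices. A shortest
  path to \<open>u\<close> can therefore be extended by the arc only if it avoids \<open>v\<close>;
  otherwise its initial segment up to \<open>v\<close> is already short enough.\<close>

lemma graph_dist_adj_le:
  assumes "x \<rightarrow>\<^sup>* u" "u \<rightarrow> v"
  shows "graph_dist G x v \<le> graph_dist G x u + 1"
proof -
  obtain p where p: "apath x p u" "length p = graph_dist G x u"
    using graph_dist_apathE[OF assms(1)] .
  have w: "awalk x p u" using p(1) by (rule awalkI_apath)
  obtain e where e: "e \<in> arcs G" "tail G e = u" "head G e = v" using assms(2) by (rule reachableE)
  show ?thesis
  proof (cases "v \<in> set (awalk_verts x p)")
    case True
    then obtain q r where qr: "p = q @ r" "awalk x q v"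
      using awalk_decomp[OF w] by blast
    hence "apath x q v" using p(1) by (auto simp: apath_def awalk_verts_append)
    thus ?thesis using graph_dist_le[of x q v] p(2) qr(1) by simp
  next
    case False
    have "awalk x (p @ [e]) v" using w e by (intro awalk_appendI[of _ _ u]) (auto simp: awalk_simps)
    moreover have "distinct (awalk_verts x (p @ [e]))"
      using False p(1) e calculation by (auto simp: awalk_verts_append apath_def)
    ultimately have "apath x (p @ [e]) v" by (simp add: apath_def)
    thus ?thesis using graph_dist_le[of x "p @ [e]" v] p(2) by simp
  qed
qed

text \<open>A potential that rises by at most \<open>c\<close> per arc turns a labelling of the
  vertices into a lower bound on distances.\<close>

lemma awalk_length_ge_potential:
  fixes f :: "'a \<Rightarrow> nat"
  assumes "awalk u p v" "\<And>e. e \<in> arcs G \<Longrightarrow> f (head G e) \<le> f (tail G e) + c"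
  shows "f v \<le> f u + c * length p"
  using assms(1)
proof (induction p arbitrary: u)
  case (Cons e p)
  hence "e \<in> arcs G" "u = tail G e" "f v \<le> f (head G e) + c * length p"
    by (auto simp: awalk_simps)
  thus ?case using assms(2)[of e] by simp
qed (simp add: awalk_simps)

end

section \<open>Upper bound on the status\<close>

lemma k_connected_sphere_card:
  assumes "k_connected k G" "k \<ge> 1" "card (verts G) \<ge> k + 1" "x \<in> verts G"
    and z: "z \<in> verts G" "graph_dist G x z > j + 1"
  shows "k \<le> card {y \<in> verts G. graph_dist G x y = j + 1}" (is "k \<le> card ?N")
proof (rule ccontr)
  interpret graph G using assms(1) by (simp add: k_connected_def)
  have conn: "Digraph_Component.connected G" using assms(1) by (simp add: k_connected_def)
  assume "\<not> k \<le> card ?N"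
  hence N: "card ?N \<le> k - 1" by simp
  have "x \<noteq> z" using z(2) graph_dist_self[OF assms(4)] by auto
  \<comment> \<open>\<open>k_connected\<close> speaks of sets of exactly \<open>k - 1\<close>
    vertices, so the small sphere is padded to that size without using \<open>x\<close> or
    \<open>z\<close>; order at least \<open>k + 1\<close> leaves room for this.\<close>
  hence "card (verts G - {x, z}) \<ge> k - 1"
    using assms(3,4) z(1) by (subst card_Diff_subset) auto
  moreover have "?N \<subseteq> verts G - {x, z}" using z graph_dist_self[OF assms(4)] by auto
  ultimately obtain S where S: "?N \<subseteq> S" "S \<subseteq> verts G - {x, z}" "card S = k - 1"
    using exists_subset_between[of ?N "k - 1" "verts G - {x, z}"] N by auto
  define H where "H = G \<restriction> (verts G - S)"
  have conn_H: "Digraph_Component.connected H"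
    using assms(1) S unfolding k_connected_def H_def by blast
  interpret H: graph H unfolding H_def by (rule graph_induce_subgraph) auto
  have "x \<in> verts H" "z \<in> verts H" using S assms(4) z(1) by (auto simp: H_def)
  hence "x \<rightarrow>\<^sup>*\<^bsub>H\<^esub> z" using H.connected_imp_reachable conn_H by blast
  \<comment> \<open>Distances are taken in \<open>G\<close>, reachability in \<open>H\<close>. Along
    an arc of \<open>H\<close> the distance rises by at most 1, and the value \<open>j + 1\<close>
    occurs only on deleted vertices, so it is never passed.\<close>
  hence "graph_dist G x z \<le> j"
  proof (induction rule: H.reachable_induct)
    case base
    show ?case using graph_dist_self[OF assms(4)] by simp
  next
    case (step u v)
    from step(2) have uv: "u \<rightarrow>\<^bsub>G\<^esub> v" "v \<notin> S" "u \<in> verts G" "v \<in> verts G"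
      unfolding H_def by (auto simp: arcs_ends_conv induce_subgraph_def)
    have "graph_dist G x v \<le> graph_dist G x u + 1"
      using connected_imp_reachable[OF conn assms(4) uv(3)] uv(1) by (rule graph_dist_adj_le)
    moreover have "graph_dist G x v \<noteq> j + 1" using uv S(1) by auto
    ultimately show ?case using step(3) by simp
  qed
  thus False using z(2) by simp
qed

lemma k_connected_card_dist_greater:
  assumes "k_connected k G" "k \<ge> 1" "card (verts G) \<ge> k + 1" "x \<in> verts G"
  shows "card {y \<in> verts G. j < graph_dist G x y} \<le> card (verts G) - 1 - j * k"
proof (induction j)
  interpret graph G using assms(1) by (simp add: k_connected_def)
  case 0
  have "{y \<in> verts G. 0 < graph_dist G x y} \<subseteq> verts G - {x}"
    using graph_dist_self[OF assms(4)] by auto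
  hence "card {y \<in> verts G. 0 < graph_dist G x y} \<le> card (verts G - {x})"
    by (intro card_mono) auto
  thus ?case using assms(4) by simp
next
  interpret graph G using assms(1) by (simp add: k_connected_def)
  case (Suc j)
  show ?case
  \<comment> \<open>The sphere of radius \<open>j + 1\<close> is known to be large only if some
    vertex lies beyond it; otherwise the count is 0.\<close>
  proof (cases "{y \<in> verts G. Suc j < graph_dist G x y} = {}")
    case False
    then obtain z where "z \<in> verts G" "graph_dist G x z > j + 1" by auto
    hence "k \<le> card {y \<in> verts G. graph_dist G x y = j + 1}"
      using k_connected_sphere_card[OF assms] by blast
    moreover have "{y \<in> verts G. j < graph_dist G x y}
      = {y \<in> verts G. graph_dist G x y = j + 1} \<union> {y \<in> verts G. Suc j < graph_dist G x y}"
      by auto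
    hence "card {y \<in> verts G. j < graph_dist G x y}
      = card {y \<in> verts G. graph_dist G x y = j + 1} + card {y \<in> verts G. Suc j < graph_dist G x y}"
      by (simp only:) (rule card_Un_disjoint, auto)
    ultimately show ?thesis using Suc by simp
  qed (simp only: card.empty)
qed

lemma k_connected_status_eq:
  assumes "k_connected k G" "k \<ge> 1" "card (verts G) \<ge> k + 1" "x \<in> verts G"
  shows "status x G = (\<Sum>j<card (verts G). card {y \<in> verts G. j < graph_dist G x y})"
  unfolding status_def
proof (rule sum_eq_sum_card_greater)
  interpret graph G using assms(1) by (simp add: k_connected_def)
  show "finite (verts G)" by simp
  fix y assume y: "y \<in> verts G"
  show "graph_dist G x y \<le> card (verts G)"
  proof (rule ccontr)
    assume "\<not> graph_dist G x y \<le> card (verts G)"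
    hence "y \<in> {y \<in> verts G. card (verts G) < graph_dist G x y}" using y by simp
    \<comment> \<open>At level \<open>card (verts G)\<close> the truncated bound is 0, so no vertex
      is farther away and the sum over levels may stop there.\<close>
    moreover have "card (verts G) - 1 \<le> card (verts G) * k"
      using assms(2) by (intro order_trans[OF diff_le_self]) simp
    hence "card {y \<in> verts G. card (verts G) < graph_dist G x y} = 0"
      using k_connected_card_dist_greater[OF assms, of "card (verts G)"] by linarith
    ultimately show False by (simp add: card_eq_0_iff) blast
  qed
qed

lemma k_connected_status_le:
  assumes "k_connected k G" "k \<ge> 1" "card (verts G) \<ge> k + 1" "x \<in> verts G"
  shows "status x G \<le> (\<Sum>j<card (verts G). card (verts G) - 1 - j * k)"
  unfolding k_connected_status_eq[OF assms]
  by (intro sum_mono k_connected_card_dist_greater assms)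

section \<open>Sharpness: powers of a path\<close>

text \<open>The two inequalities express \<open>|u - v| \<le> k\<close> without truncated
  subtraction. For \<open>k = 1\<close> this is the path itself.\<close>

definition path_power :: "nat \<Rightarrow> nat \<Rightarrow> (nat, nat \<times> nat) pre_digraph" where
  "path_power n k = \<lparr>verts = {..<n}, arcs = {(u, v). u < n \<and> v < n \<and> u \<noteq> v \<and> u \<le> v + k \<and> v \<le> u + k},
     tail = fst, head = snd\<rparr>"

lemma verts_path_power [simp]: "verts (path_power n k) = {..<n}"
  by (simp add: path_power_def)

lemma graph_path_power: "graph (path_power n k)"
proof
  show "finite (arcs (path_power n k))"
    by (rule finite_subset[of _ "{..<n} \<times> {..<n}"]) (auto simp: path_power_def)
  show "symmetric (path_power n k)"
    unfolding symmetric_def arcs_ends_conv sym_def path_power_def by force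
qed (auto simp: path_power_def arc_to_ends_def)

text \<open>Each vertex of \<open>W\<close> other than the least is adjacent to its predecessor in
  \<open>W\<close>. A general \<open>W\<close> covers both the whole graph and the graph after a
  deletion.\<close>

lemma connected_path_power_induce:
  assumes W: "W \<subseteq> {..<n}" "W \<noteq> {}" and small: "card ({..<n} - W) < k"
  shows "Digraph_Component.connected (path_power n k \<restriction> W)" (is "Digraph_Component.connected ?H")
proof -
  interpret P: graph "path_power n k" by (rule graph_path_power)
  interpret H: graph ?H using W by (intro P.graph_induce_subgraph) simp
  define m where "m = (LEAST w. w \<in> W)"
  have m: "m \<in> W" "\<And>w. w \<in> W \<Longrightarrow> m \<le> w"
    using W(2) unfolding m_def by (auto intro: LeastI Least_le)
  have fin: "finite W" using W(1) finite_subset by blast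
  have reach: "m \<rightarrow>\<^sup>*\<^bsub>?H\<^esub> w" if "w \<in> W" for w
    using that
  proof (induction w rule: less_induct)
    case (less w)
    show ?case
    proof (cases "w = m")
      case True
      thus ?thesis using m by simp
    next
      case False
      define w' where "w' = Max {v \<in> W. v < w}"
      have "{v \<in> W. v < w} \<noteq> {}" using m less.prems False le_neq_implies_less by blast
      hence w': "w' \<in> W" "w' < w" and max: "\<And>v. v \<in> W \<Longrightarrow> v < w \<Longrightarrow> v \<le> w'"
        using Max_in[of "{v \<in> W. v < w}"] fin unfolding w'_def by auto
      \<comment> \<open>All numbers strictly between \<open>w'\<close> and \<open>w\<close> are
        missing from \<open>W\<close>, and fewer than \<open>k\<close> are missing, so the gap is at
        most \<open>k\<close>.\<close>
      have "{w'<..<w} \<subseteq> {..<n} - W" using max W(1) less.prems by fastforce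
      hence "card {w'<..<w} \<le> card ({..<n} - W)" by (intro card_mono) auto
      hence "w \<le> w' + k" using small by simp
      hence "(w', w) \<in> arcs ?H"
        using w' less.prems W(1) by (auto simp: path_power_def induce_subgraph_def)
      hence "w' \<rightarrow>\<^bsub>?H\<^esub> w"
        unfolding arcs_ends_conv by (force simp: path_power_def induce_subgraph_def)
      thus ?thesis using less.IH[OF w'(2,1)] H.reachable_adj_trans by blast
    qed
  qed
  show ?thesis
  proof (rule H.connectedI)
    fix u v assume "u \<in> verts ?H" "v \<in> verts ?H"
    hence "m \<rightarrow>\<^sup>*\<^bsub>?H\<^esub> u" "m \<rightarrow>\<^sup>*\<^bsub>?H\<^esub> v" using reach by simp_all
    hence "u \<rightarrow>\<^sup>*\<^bsub>?H\<^esub> v" using H.symmetric_reachable' H.reachable_trans by blast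
    \<comment> \<open>Connectedness refers to the symmetric closure, which has the same reachability
      because the arcs are already symmetric.\<close>
    thus "u \<rightarrow>\<^sup>*\<^bsub>mk_symmetric ?H\<^esub> v" by (simp only: H.reachable_mk_symmetric_eq[OF H.sym_arcs])
  qed (use W in simp)
qed

lemma k_connected_path_power:
  assumes "n > k + 1" "k \<ge> 1"
  shows "k_connected k (path_power n k)"
  unfolding k_connected_def
proof (intro conjI allI impI)
  show "graph (path_power n k)" by (rule graph_path_power)
  have "path_power n k \<restriction> {..<n} = path_power n k" by (auto simp: path_power_def induce_subgraph_def)
  thus "Digraph_Component.connected (path_power n k)"
    using connected_path_power_induce[of "{..<n}" n k] assms by auto
  fix S assume S: "S \<subseteq> verts (path_power n k)" "card S = k - 1"
  have "finite S" using S(1) finite_subset by auto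
  \<comment> \<open>At least three vertices survive, since \<open>n > k + 1\<close>.\<close>
  hence c: "card ({..<n} - S) = n - (k - 1)" using S by (simp add: card_Diff_subset)
  show "card (verts (path_power n k \<restriction> (verts (path_power n k) - S))) \<noteq> 1"
    using c assms by simp
  have "{..<n} - S \<noteq> {}" using c assms by (intro notI) simp
  moreover have "{..<n} - ({..<n} - S) = S" using S(1) by auto
  ultimately show "Digraph_Component.connected (path_power n k \<restriction> (verts (path_power n k) - S))"
    using connected_path_power_induce[of "{..<n} - S" n k] S(2) assms by auto
qed

text \<open>Labels change by at most \<open>k\<close> along an arc, so the identity serves as
  potential; connectedness guarantees that a shortest path exists.\<close>

lemma path_power_dist_ge:
  assumes "k_connected k (path_power n k)" "v < n"
  shows "v \<le> k * graph_dist (path_power n k) 0 v"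
proof -
  interpret graph "path_power n k" by (rule graph_path_power)
  have "0 \<rightarrow>\<^sup>*\<^bsub>path_power n k\<^esub> v"
    using connected_imp_reachable assms by (auto simp: k_connected_def)
  then obtain p where p: "apath 0 p v" "length p = graph_dist (path_power n k) 0 v"
    by (rule graph_dist_apathE)
  have "v \<le> 0 + k * length p"
    by (rule awalk_length_ge_potential[where f = id, simplified, OF awalkI_apath[OF p(1)]])
       (auto simp: path_power_def)
  thus ?thesis using p(2) by simp
qed

lemma status_path_power:
  assumes "n > k + 1" "k \<ge> 1"
  shows "status 0 (path_power n k) \<ge> (\<Sum>j<n. n - 1 - j * k)"
proof -
  let ?G = "path_power n k"
  have kc: "k_connected k ?G" using assms by (rule k_connected_path_power)
  have "(\<Sum>j<n. n - 1 - j * k) \<le> (\<Sum>j<n. card {y \<in> verts ?G. j < graph_dist ?G 0 y})"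
  proof (rule sum_mono)
    fix j
    \<comment> \<open>The labels above \<open>j * k\<close> number exactly
      \<open>n - 1 - j * k\<close>, truncation included.\<close>
    have "{j * k<..<n} \<subseteq> {y \<in> verts ?G. j < graph_dist ?G 0 y}"
    proof
      fix v assume v: "v \<in> {j * k<..<n}"
      hence "v \<le> k * graph_dist ?G 0 v" using path_power_dist_ge[OF kc] by simp
      hence "k * j < k * graph_dist ?G 0 v"
        using v mult.commute[of j k] unfolding greaterThanLessThan_iff by linarith
      thus "v \<in> {y \<in> verts ?G. j < graph_dist ?G 0 y}" using v nat_mult_less_cancel_disj by auto
    qed
    hence "card {j * k<..<n} \<le> card {y \<in> verts ?G. j < graph_dist ?G 0 y}"
      by (intro card_mono) auto
    thus "n - 1 - j * k \<le> card {y \<in> verts ?G. j < graph_dist ?G 0 y}" by simp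
  qed
  also have "\<dots> = status 0 ?G" using k_connected_status_eq[OF kc] assms by simp
  finally show ?thesis .
qed

theorem theorem4p2:
  fixes n k :: nat
  assumes "n - 1 > k" and "k \<ge> 1"
  shows "(\<forall>G :: ('a, 'b) pre_digraph. k_connected k G \<and> card (verts G) = n \<longrightarrow>
            (\<forall>x \<in> verts G. real (status x G) \<le>
               1 / 2 * real_of_int \<lfloor>(real n + real k - 2) / real k\<rfloor> *
                 (2 * real n + real k - 2 - real k * real_of_int \<lfloor>(real n + real k - 2) / real k\<rfloor>))) \<and>
         (k = 1 \<or> k \<ge> 2 \<and> even k \<longrightarrow>
            (\<exists>G :: (nat, nat \<times> nat) pre_digraph. k_connected k G \<and> card (verts G) = n \<and>
              (\<exists>x \<in> verts G. real (status x G) =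
                 1 / 2 * real_of_int \<lfloor>(real n + real k - 2) / real k\<rfloor> *
                   (2 * real n + real k - 2 - real k * real_of_int \<lfloor>(real n + real k - 2) / real k\<rfloor>))))"
proof -
  have n: "n > k + 1" "n \<ge> 2" using assms by auto
  \<comment> \<open>With the bound rewritten as a sum of naturals, both claims become statements
    about \<open>nat\<close>.\<close>
  have bound: "1 / 2 * real_of_int \<lfloor>(real n + real k - 2) / real k\<rfloor> *
      (2 * real n + real k - 2 - real k * real_of_int \<lfloor>(real n + real k - 2) / real k\<rfloor>)
    = real (\<Sum>j<n. n - 1 - j * k)"
    unfolding floor_eq_div[OF n(2)] sum_truncated_progression[OF n(2) assms(2)] by simp
  have kc: "k_connected k (path_power n k)" using n(1) assms(2) by (rule k_connected_path_power)
  have x: "0 \<in> verts (path_power n k)" using n by simp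
  \<comment> \<open>The general upper bound, applied to the path power, meets its lower
    bound.\<close>
  have "status 0 (path_power n k) = (\<Sum>j<n. n - 1 - j * k)"
    using k_connected_status_le[OF kc assms(2) _ x] status_path_power[OF n(1) assms(2)] n(1) by simp
  thus ?thesis
    unfolding bound of_nat_le_iff of_nat_eq_iff
    by (intro conjI allI impI ballI)
       (use k_connected_status_le[OF _ assms(2)] n(1) in fastforce,
        use kc x in \<open>auto intro!: exI[of _ "path_power n k"] bexI[of _ 0]\<close>)
qed

end
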